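(* Let $R$ be a commutative ring. If $|R|\leqslant|\operatorname{Spec}(R)|$, then $\operatorname{Spec}(R)$ is infinite.
   Context: All rings are commutative with $1$. $|X|$ denotes the cardinality of a set $X$. *)

theory Defs
  imports "HOL-Algebra.Ideal" "HOL-Library.Equipollence"
begin

definition Spec :: "('a, 'b) ring_scheme \<Rightarrow> 'a set set"
  where "Spec R = {P. primeideal P R}"

end

theory Submission
  imports Defs
begin

text \<open>
  If \<open>Spec R\<close> is finite, then for each prime \<open>P\<close> some \<open>x\<^sub>P \<notin> P\<close> lies in every prime not
  contained in \<open>P\<close>. Of two distinct primes, one is not contained in the other, so the elements
  \<open>x\<^sub>P\<close> are distinct. They are also nonzero, so \<open>R\<close> has more elements than \<open>Spec R\<close>.
\<close>

text \<open>Multiply together one element of \<open>J - I\<close> for each \<open>J\<close> in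
  \<open>S\<close>: absorption keeps the product in every \<open>J\<close>, and primality keeps it
  outside \<open>I\<close>.\<close>

lemma (in primeideal) ex_mem_ideals_not_mem:
  assumes "finite S" "\<And>J. J \<in> S \<Longrightarrow> ideal J R" "\<And>J. J \<in> S \<Longrightarrow> \<not> J \<subseteq> I"
  shows "\<exists>x \<in> carrier R. x \<notin> I \<and> (\<forall>J\<in>S. x \<in> J)"
  using assms
proof (induction S)
  case empty
  \<comment> \<open>The empty product is replaced by any element outside \<open>I\<close>, which
    exists because \<open>I\<close> is proper.\<close>
  then show ?case
    using I_notcarr a_subset by auto
next
  case (insert J S)
  then obtain x where x: "x \<in> carrier R" "x \<notin> I" "\<forall>K\<in>S. x \<in> K"
    by auto
  obtain y where y: "y \<in> J" "y \<notin> I"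
    using insert.prems(2) by blast
  have J: "ideal J R"
    using insert.prems(1) by simp
  then have yc: "y \<in> carrier R"
    using y(1) ideal.Icarr by metis
  have "x \<otimes> y \<notin> I"
    using I_prime x y yc by blast
  moreover have "x \<otimes> y \<in> J"
    using ideal.I_l_closed[OF J y(1) x(1)] .
  moreover have "x \<otimes> y \<in> K" if "K \<in> S" for K
    using insert.prems(1)[of K] x(3) yc that by (simp add: ideal.I_r_closed)
  ultimately show ?case
    using x(1) yc by auto
qed

lemma finite_Spec_lepoll_nonzero:
  fixes R (structure)
  assumes fin: "finite (Spec R)"
  shows "Spec R \<lesssim> carrier R - {\<zero>}"
proof -
  have "\<exists>x \<in> carrier R. x \<notin> P \<and> (\<forall>Q\<in>{Q \<in> Spec R. \<not> Q \<subseteq> P}. x \<in> Q)" if "P \<in> Spec R" for P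
    using that fin
    by (intro primeideal.ex_mem_ideals_not_mem) (auto simp: Spec_def primeideal.axioms(1))
  then have "\<forall>P\<in>Spec R. \<exists>x. x \<in> carrier R \<and> x \<notin> P
      \<and> (\<forall>Q\<in>{Q \<in> Spec R. \<not> Q \<subseteq> P}. x \<in> Q)"
    by blast
  from bchoice[OF this] obtain f where "\<forall>P\<in>Spec R. f P \<in> carrier R \<and> f P \<notin> P
      \<and> (\<forall>Q\<in>{Q \<in> Spec R. \<not> Q \<subseteq> P}. f P \<in> Q)"
    by blast
  then have f: "\<And>P. P \<in> Spec R \<Longrightarrow> f P \<in> carrier R"
      "\<And>P. P \<in> Spec R \<Longrightarrow> f P \<notin> P"
      "\<And>P Q. \<lbrakk>P \<in> Spec R; Q \<in> Spec R; \<not> Q \<subseteq> P\<rbrakk> \<Longrightarrow> f P \<in> Q"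
    by auto
  have "inj_on f (Spec R)"
    by (rule inj_onI) (metis f(2,3) subset_antisym)
  moreover have "f P \<noteq> \<zero>" if "P \<in> Spec R" for P
  proof -
    have "\<zero> \<in> P"
      using that by (auto simp: Spec_def intro!: additive_subgroup.zero_closed
          ideal.axioms(1) primeideal.axioms(1))
    then show ?thesis
      using f(2)[OF that] by auto
  qed
  ultimately show ?thesis
    using f(1) by (auto simp: lepoll_def intro!: exI[of _ f])
qed

theorem proposition4p2:
  fixes R :: "('a, 'b) ring_scheme"
  assumes "cring R"
    and "carrier R \<lesssim> Spec R"
  shows "infinite (Spec R)"
proof
  interpret cring R by fact
  assume fin: "finite (Spec R)"
  \<comment> \<open>Finiteness is what makes an injection into the complement of zero absurd, since
    an infinite set can embed in a proper subset of itself.\<close>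
  have "finite (carrier R)"
    using fin assms(2) by (meson infinite_le_lepoll lepoll_trans)
  moreover have "carrier R \<lesssim> carrier R - {\<zero>\<^bsub>R\<^esub>}"
    using assms(2) finite_Spec_lepoll_nonzero[OF fin] by (rule lepoll_trans)
  ultimately have "card (carrier R) \<le> card (carrier R - {\<zero>\<^bsub>R\<^esub>})"
    using lepoll_iff_card_le by blast
  then show False
    using \<open>finite (carrier R)\<close> card_Diff1_less[OF _ zero_closed] leD by blast
qed

end
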